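(* Let $S\subseteq\mathbb{N}^p$ be an affine semigroup, let $\tau_1,\ldots,\tau_t$ be the extremal rays of $\mathcal{C}_S$, and let $P$ be a (non-empty) ideal of $S$. Then the following are equivalent: (a) $P\cup\{0\}$ is an affine semigroup and $\mathcal{C}_P=\mathcal{C}_S$; (b) there exists $Y\subset P\setminus\{0\}$ such that $Y\cap\tau_i\neq\emptyset$ for all $i\in\{1,\ldots,t\}$.
   Context: $\mathbb{N}$ contains $0$, and $p\ge 1$. An affine semigroup $S\subseteq\mathbb{N}^p$ is a finitely generated submonoid of $(\mathbb{N}^p,+)$ (containing $0$). An ideal of $S$ is a non-empty subset $P\subseteq S$ with $P+S\subseteq P$. For $B\subseteq\mathbb{N}^p$, $\mathcal{C}_B=\{\sum_{i=1}^k\lambda_i b_i\mid k\in\mathbb{N},\ \lambda_i\in\mathbb{Q}_{\ge 0},\ b_i\in B\}\cap\mathbb{N}^p$ is the non-negative integer cone generated by $B$. The extremal rays of $\mathcal{C}_S$ are the one-dimensional faces of the rational cone generated by $S$ (intersected with $\mathbb{N}^p$). *)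

theory Defs
  imports "HOL-Analysis.Analysis"
begin

definition submonoid :: "'a::comm_monoid_add set \<Rightarrow> bool" where
  "submonoid T \<longleftrightarrow> 0 \<in> T \<and> (\<forall>x\<in>T. \<forall>y\<in>T. x + y \<in> T)"

definition affine_semigroup :: "(nat ^ 'p) set \<Rightarrow> bool" where
  "affine_semigroup S \<longleftrightarrow> (\<exists>G. finite G \<and> S = submonoid hull G)"

definition semigroup_ideal :: "'a::comm_monoid_add set \<Rightarrow> 'a set \<Rightarrow> bool" where
  "semigroup_ideal P S \<longleftrightarrow> P \<noteq> {} \<and> P \<subseteq> S \<and> (\<forall>x\<in>P. \<forall>s\<in>S. x + s \<in> P)"

definition rat_vec :: "nat ^ 'p \<Rightarrow> rat ^ 'p" where
  "rat_vec x = (\<chi> i. of_nat (x $ i))"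

definition rat_cone :: "(nat ^ 'p) set \<Rightarrow> (rat ^ 'p) set" where
  "rat_cone B = {\<Sum>i<k. c i *s rat_vec (b i) | (k::nat) c b. \<forall>i<k. 0 \<le> c i \<and> b i \<in> B}"

definition int_points :: "(rat ^ 'p) set \<Rightarrow> (nat ^ 'p) set" where
  "int_points A = {x. rat_vec x \<in> A}"

definition int_cone :: "(nat ^ 'p) set \<Rightarrow> (nat ^ 'p) set" where
  "int_cone B = int_points (rat_cone B)"

text \<open>
  The library notions \<^const>\<open>convex\<close> and \<^const>\<open>face_of\<close> require a real vector space,
  so they are restated here, word for word, over an arbitrary ordered field;
  lemma \<open>field_face_of_real\<close> confirms that they agree over the reals.
  For finitely generated cones these faces are the nonempty intersections with supporting
  hyperplanes, together with the empty face and the whole cone.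
\<close>

definition field_convex :: "('a::linordered_field ^ 'p) set \<Rightarrow> bool" where
  "field_convex T \<longleftrightarrow>
     (\<forall>x\<in>T. \<forall>y\<in>T. \<forall>u\<ge>0. \<forall>v\<ge>0. u + v = 1 \<longrightarrow> u *s x + v *s y \<in> T)"

definition field_open_segment :: "'a::linordered_field ^ 'p \<Rightarrow> 'a ^ 'p \<Rightarrow> ('a ^ 'p) set" where
  "field_open_segment a b = {(1 - u) *s a + u *s b | u. a \<noteq> b \<and> 0 < u \<and> u < 1}"

definition field_face_of :: "('a::linordered_field ^ 'p) set \<Rightarrow> ('a ^ 'p) set \<Rightarrow> bool" where
  "field_face_of T C \<longleftrightarrow> T \<subseteq> C \<and> field_convex T \<and>
     (\<forall>a\<in>C. \<forall>b\<in>C. \<forall>x\<in>T. x \<in> field_open_segment a b \<longrightarrow> a \<in> T \<and> b \<in> T)"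

lemma field_face_of_real: "field_face_of T C \<longleftrightarrow> T face_of C"
  for T C :: "(real ^ 'p) set"
proof -
  have "field_convex T \<longleftrightarrow> convex T"
    by (simp add: field_convex_def convex_def scalar_mult_eq_scaleR)
  moreover have "field_open_segment a b = open_segment a b" for a b :: "real ^ 'p"
    by (auto simp: field_open_segment_def in_segment scalar_mult_eq_scaleR)
  ultimately show ?thesis
    by (simp add: field_face_of_def face_of_def)
qed

text \<open>
  A nonempty face of a cone contains 0, so its dimension is the dimension of its linear span.
\<close>

definition extremal_rays :: "(nat ^ 'p) set \<Rightarrow> (nat ^ 'p) set set" where
  "extremal_rays S = {int_points F | F. field_face_of F (rat_cone S) \<and> vec.dim F = 1}"

end

theory Submission
  imports Defs
begin

text \<open>
  For (a) \<open>\<Longrightarrow>\<close> (b), a nonzero point of an extremal ray is a nonnegative combination of elements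
  of \<open>P\<close>, and the terms of this combination lie on the ray because the ray is a face.

  For (b) \<open>\<Longrightarrow>\<close> (a), a minimal generating set of the cone of \<open>S\<close> consists of vectors spanning
  extremal rays, since the cone contains no line; hence \<open>P\<close> generates the same cone, and
  clearing denominators gives every generator \<open>g\<close> of \<open>S\<close> a multiple \<open>n\<^sub>g g \<in> P \<union> {0}\<close> with
  \<open>n\<^sub>g > 0\<close>. By division with remainder \<open>S = R + M\<close> with \<open>R\<close> finite and \<open>M\<close> generated by the
  \<open>n\<^sub>g g\<close>, and by Dickson's lemma \<open>P = A + S\<close> with \<open>A \<subseteq> P\<close> finite. So \<open>P = (A + R) + M\<close>.
\<close>

section \<open>Finitely generated monoids\<close>

lemma submonoid_hull: "submonoid (submonoid hull G)"
  by (rule hull_in) (auto simp: submonoid_def)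

lemma submonoid_hull_zero: "0 \<in> submonoid hull G"
  using submonoid_hull by (auto simp: submonoid_def)

lemma submonoid_hull_add:
  "x \<in> submonoid hull G \<Longrightarrow> y \<in> submonoid hull G \<Longrightarrow> x + y \<in> submonoid hull G"
  using submonoid_hull by (auto simp: submonoid_def)

lemma smult_nat_in_submonoid:
  fixes x :: "nat ^ 'p"
  assumes "submonoid T" "x \<in> T"
  shows "n *s x \<in> T"
proof (induction n)
  case 0
  have "0 *s x = 0" by (simp add: vec_eq_iff)
  then show ?case using assms by (simp add: submonoid_def)
next
  case (Suc n)
  have "Suc n *s x = x + n *s x" by (simp add: vec_eq_iff)
  then show ?case using Suc assms by (simp add: submonoid_def)
qed

text \<open>Collecting all copies of \<open>g\<close> into one term is possible by commutativity.
  This separates one generator from the others and drives the inductions on \<open>G\<close>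
  below.\<close>

lemma submonoid_hull_insert:
  fixes g :: "nat ^ 'p"
  shows "submonoid hull (insert g G) = {k *s g + h | k h. h \<in> submonoid hull G}" (is "_ = ?R")
proof (rule hull_unique)
  have RI: "x \<in> ?R" if "x = k *s g + h" "h \<in> submonoid hull G" for x k h
    using that by blast
  have "g \<in> ?R" by (rule RI[of _ 1 0]) (simp_all add: vec_eq_iff submonoid_hull_zero)
  moreover have "x \<in> ?R" if "x \<in> G" for x
    by (rule RI[of _ 0 x]) (simp_all add: vec_eq_iff hull_inc that)
  ultimately show "insert g G \<subseteq> ?R" by (auto simp del: mem_Collect_eq)
  have "0 \<in> ?R" by (rule RI[of _ 0 0]) (simp_all add: vec_eq_iff submonoid_hull_zero)
  moreover have "x + y \<in> ?R" if xy: "x \<in> ?R" "y \<in> ?R" for x y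
  proof -
    obtain k h l i where "x = k *s g + h" "h \<in> submonoid hull G"
      "y = l *s g + i" "i \<in> submonoid hull G" using xy by blast
    then show ?thesis
      by (intro RI[of _ "k + l" "h + i"])
        (simp_all add: vec_eq_iff distrib_right ac_simps submonoid_hull_add)
  qed
  ultimately show "submonoid ?R" unfolding submonoid_def by (intro conjI ballI)
next
  fix T assume T: "insert g G \<subseteq> T" "submonoid T"
  then have "submonoid hull G \<subseteq> T" by (simp add: hull_minimal)
  then show "?R \<subseteq> T" using T smult_nat_in_submonoid[of T g] by (auto simp: submonoid_def)
qed

text \<open>Dickson's lemma, by induction on the generators. \<open>A\<close> is sliced by the
  coefficient of the new generator \<open>g\<close>. Finitely many elements serve the union of all
  slices, and from some level on they dominate every slice; each of the finitely many lower slices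
  is treated separately.\<close>

lemma submonoid_hull_dickson:
  fixes G :: "(nat ^ 'p) set"
  assumes "finite G" "A \<subseteq> submonoid hull G"
  shows "\<exists>F. finite F \<and> F \<subseteq> A \<and> (\<forall>a\<in>A. \<exists>f\<in>F. \<exists>h\<in>submonoid hull G. a = f + h)"
  using assms
proof (induction G arbitrary: A rule: finite_induct)
  case empty
  have "submonoid hull {} = {0 :: nat ^ 'p}"
    by (rule hull_unique) (auto simp: submonoid_def)
  then show ?case using empty finite_subset[of A "{0}"] by (intro exI[of _ A]) auto
next
  case (insert g G)
  let ?H = "submonoid hull G" and ?H' = "submonoid hull (insert g G)"
  \<comment> \<open>The slices need not increase with \<open>k\<close>, since \<open>A\<close> is an
    arbitrary subset; hence the union of all of them is considered first.\<close>
  define L where "L k = {h \<in> ?H. k *s g + h \<in> A}" for k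
  have "(\<Union>k. L k) \<subseteq> ?H" by (auto simp: L_def)
  from insert.IH[OF this] obtain F where F: "finite F" "F \<subseteq> (\<Union>k. L k)"
    "\<forall>a\<in>(\<Union>k. L k). \<exists>f\<in>F. \<exists>h\<in>?H. a = f + h" by blast
  from F(2) have "\<forall>f\<in>F. \<exists>k. f \<in> L k" by blast
  then obtain \<kappa> where \<kappa>: "\<And>f. f \<in> F \<Longrightarrow> f \<in> L (\<kappa> f)" by metis
  \<comment> \<open>The inserted 0 keeps \<open>Max\<close> meaningful when \<open>F\<close> is
    empty.\<close>
  define K where "K = Max (insert 0 (\<kappa> ` F))"
  have K: "\<kappa> f \<le> K" if "f \<in> F" for f using that F(1) by (simp add: K_def)
  have "\<exists>E. finite E \<and> E \<subseteq> L k \<and> (\<forall>a\<in>L k. \<exists>f\<in>E. \<exists>h\<in>?H. a = f + h)" for k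
    by (rule insert.IH) (auto simp: L_def)
  then obtain E where E: "\<And>k. finite (E k)" "\<And>k. E k \<subseteq> L k"
    "\<And>k a. a \<in> L k \<Longrightarrow> \<exists>f\<in>E k. \<exists>h\<in>?H. a = f + h" by metis
  let ?F = "(\<lambda>f. \<kappa> f *s g + f) ` F \<union> (\<Union>k<K. (\<lambda>f. k *s g + f) ` E k)"
  have cover: "\<exists>f\<in>?F. \<exists>h\<in>?H'. a = f + h" if a: "a \<in> A" for a
  proof -
    obtain k h where kh: "a = k *s g + h" "h \<in> ?H"
      using a insert.prems by (auto simp: submonoid_hull_insert)
    then have hL: "h \<in> L k" using a by (auto simp: L_def)
    show ?thesis
    proof (cases "k < K")
      case True
      obtain f i where fi: "f \<in> E k" "i \<in> ?H" "h = f + i" using E(3)[OF hL] by blast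
      have "i \<in> ?H'" using fi(2) hull_mono[OF subset_insertI] by (rule rev_subsetD)
      moreover have "a = (k *s g + f) + i" using kh fi by (simp add: add.assoc)
      moreover have "k *s g + f \<in> ?F" using True fi(1) by auto
      ultimately show ?thesis by (intro bexI)
    next
      case False
      obtain f i where fi: "f \<in> F" "i \<in> ?H" "h = f + i" using F(3) hL by blast
      \<comment> \<open>At level \<open>K\<close> or above, \<open>f\<close> already occurs at a
        level not exceeding \<open>k\<close>, and the surplus copies of \<open>g\<close> are
        absorbed by the monoid.\<close>
      have le: "\<kappa> f \<le> k" using K[OF fi(1)] False by simp
      have "(k - \<kappa> f) *s g + i \<in> ?H'" using fi(2) by (auto simp: submonoid_hull_insert)
      moreover have "k *s g = \<kappa> f *s g + (k - \<kappa> f) *s g"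
        using le by (simp add: vec_eq_iff flip: distrib_right)
      then have "a = (\<kappa> f *s g + f) + ((k - \<kappa> f) *s g + i)"
        using kh fi by (simp add: ac_simps)
      moreover have "\<kappa> f *s g + f \<in> ?F" using fi(1) by auto
      ultimately show ?thesis by (intro bexI)
    qed
  qed
  have sub: "?F \<subseteq> A" using \<kappa> E(2) by (fastforce simp: L_def)
  have fin: "finite ?F" using F(1) E(1) by simp
  show ?case by (rule exI[of _ ?F], intro conjI ballI, rule fin, rule sub, erule cover)
qed

text \<open>Dividing the coefficient of each generator \<open>g\<close> by \<open>n g\<close> moves
  the quotient part into \<open>T\<close> and leaves a coefficient below \<open>n g\<close>, so only
  finitely many remainders arise.\<close>

lemma submonoid_hull_remainders:
  fixes G :: "(nat ^ 'p) set"
  assumes "finite G" "submonoid T" "\<And>g. g \<in> G \<Longrightarrow> n g > 0 \<and> n g *s g \<in> T"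
  shows "\<exists>R. finite R \<and> R \<subseteq> submonoid hull G \<and>
    (\<forall>s\<in>submonoid hull G. \<exists>r\<in>R. \<exists>t\<in>T. s = r + t)"
  using assms(1,3)
proof (induction G rule: finite_induct)
  case empty
  have "submonoid hull {} = {0 :: nat ^ 'p}"
    by (rule hull_unique) (auto simp: submonoid_def)
  moreover have "0 \<in> T" using assms(2) by (simp add: submonoid_def)
  ultimately show ?case by (intro exI[of _ "{0}"]) auto
next
  case (insert g G)
  let ?H = "submonoid hull G" and ?H' = "submonoid hull (insert g G)"
  obtain R where R: "finite R" "R \<subseteq> ?H" "\<forall>s\<in>?H. \<exists>r\<in>R. \<exists>t\<in>T. s = r + t"
    using insert by auto
  have n: "n g > 0" "n g *s g \<in> T" using insert.prems by auto
  let ?R = "(\<lambda>(k, r). k *s g + r) ` ({..<n g} \<times> R)"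
  have "\<exists>r\<in>?R. \<exists>t\<in>T. s = r + t" if s: "s \<in> ?H'" for s
  proof -
    obtain k h where kh: "s = k *s g + h" "h \<in> ?H"
      using s by (auto simp: submonoid_hull_insert)
    obtain r t where rt: "r \<in> R" "t \<in> T" "h = r + t" using R(3) kh(2) by blast
    have "k *s g = (k mod n g + (k div n g) * n g) *s g" by simp
    also have "\<dots> = (k mod n g) *s g + (k div n g) *s (n g *s g)"
      by (simp only: vector_sadd_rdistrib vector_smult_assoc)
    finally have "s = ((k mod n g) *s g + r) + ((k div n g) *s (n g *s g) + t)"
      using kh rt by (simp add: ac_simps)
    moreover have "(k div n g) *s (n g *s g) + t \<in> T"
      using smult_nat_in_submonoid[OF assms(2) n(2)] rt(2) assms(2) by (auto simp: submonoid_def)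
    moreover have "(k mod n g) *s g + r \<in> ?R" using n(1) rt(1) by force
    ultimately show ?thesis by blast
  qed
  moreover have "?R \<subseteq> ?H'" using R(2) by (auto simp: submonoid_hull_insert)
  ultimately show ?case using R(1) by (intro exI[of _ ?R] conjI ballI) auto
qed

section \<open>Rational cones\<close>

lemma rat_vec_zero: "rat_vec 0 = 0"
  by (simp add: rat_vec_def vec_eq_iff)

lemma rat_vec_add: "rat_vec (x + y) = rat_vec x + rat_vec y"
  by (simp add: rat_vec_def vec_eq_iff)

lemma rat_vec_smult: "rat_vec (n *s x) = of_nat n *s rat_vec x"
  by (simp add: rat_vec_def vec_eq_iff)

lemma rat_vec_eq_iff: "rat_vec x = rat_vec y \<longleftrightarrow> x = y"
  by (simp add: rat_vec_def vec_eq_iff)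

lemma rat_vec_eq_zero_iff: "rat_vec x = 0 \<longleftrightarrow> x = 0"
  using rat_vec_eq_iff[of x 0] by (simp add: rat_vec_zero)

lemma rat_cone_zero: "0 \<in> rat_cone B"
  unfolding rat_cone_def by (auto intro!: exI[of _ "0::nat"])

lemma rat_cone_add_smult:
  fixes B :: "(nat ^ 'a) set"
  assumes "x \<in> rat_cone B" "c \<ge> 0" "b \<in> B"
  shows "x + c *s rat_vec b \<in> rat_cone B"
proof -
  obtain k d and e :: "nat \<Rightarrow> nat ^ 'a" where x: "x = (\<Sum>i<k. d i *s rat_vec (e i))" "\<forall>i<k. 0 \<le> d i \<and> e i \<in> B"
    using assms(1) unfolding rat_cone_def by blast
  \<comment> \<open>The new term is stored at index \<open>k\<close>, just outside the range of the
    old sum.\<close>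
  have "x + c *s rat_vec b = (\<Sum>i<Suc k. (d(k := c)) i *s rat_vec ((e(k := b)) i))"
    using x(1) by simp
  moreover have "\<forall>i<Suc k. 0 \<le> (d(k := c)) i \<and> (e(k := b)) i \<in> B"
    using x(2) assms by (auto simp: less_Suc_eq)
  ultimately show ?thesis unfolding rat_cone_def by blast
qed

text \<open>Induction on the number of terms; it replaces indexed sums by the addition of one scaled
  generator at a time.\<close>

lemma rat_cone_induct [consumes 1, case_names zero add]:
  fixes B :: "(nat ^ 'a) set"
  assumes "x \<in> rat_cone B"
    and zero: "Q 0"
    and add: "\<And>x c b. x \<in> rat_cone B \<Longrightarrow> Q x \<Longrightarrow> c \<ge> 0 \<Longrightarrow> b \<in> B \<Longrightarrow> Q (x + c *s rat_vec b)"
  shows "Q x"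
proof -
  obtain k c and b :: "nat \<Rightarrow> nat ^ 'a" where x: "x = (\<Sum>i<k. c i *s rat_vec (b i))" "\<forall>i<k. 0 \<le> c i \<and> b i \<in> B"
    using assms(1) unfolding rat_cone_def by blast
  \<comment> \<open>Membership is carried along with \<open>Q\<close> because \<open>add\<close>
    requires the partial sum to lie in the cone.\<close>
  have "\<forall>i<k. 0 \<le> c i \<and> b i \<in> B \<Longrightarrow>
    (\<Sum>i<k. c i *s rat_vec (b i)) \<in> rat_cone B \<and> Q (\<Sum>i<k. c i *s rat_vec (b i))" for k
    by (induction k) (auto simp: zero rat_cone_zero intro: add rat_cone_add_smult)
  then show ?thesis using x by blast
qed

lemma rat_cone_base: "b \<in> B \<Longrightarrow> rat_vec b \<in> rat_cone B"
  using rat_cone_add_smult[OF rat_cone_zero, of 1] by simp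

lemma rat_cone_add:
  assumes "x \<in> rat_cone B" "y \<in> rat_cone B"
  shows "x + y \<in> rat_cone B"
  using assms(2,1)
  by (induction y rule: rat_cone_induct)
    (auto simp: add.assoc[symmetric] intro: rat_cone_add_smult)

lemma rat_cone_smult: "x \<in> rat_cone B \<Longrightarrow> c \<ge> 0 \<Longrightarrow> c *s x \<in> rat_cone B"
  by (induction x rule: rat_cone_induct)
    (auto simp: rat_cone_zero vector_add_ldistrib vector_smult_assoc intro: rat_cone_add_smult)

lemma rat_cone_least:
  assumes "\<And>b. b \<in> B \<Longrightarrow> rat_vec b \<in> rat_cone D"
  shows "rat_cone B \<subseteq> rat_cone D"
proof
  fix x assume "x \<in> rat_cone B"
  then show "x \<in> rat_cone D"
    by (induction rule: rat_cone_induct)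
      (auto simp: rat_cone_zero intro: rat_cone_add rat_cone_smult assms)
qed

lemma rat_cone_mono: "B \<subseteq> D \<Longrightarrow> rat_cone B \<subseteq> rat_cone D"
  by (rule rat_cone_least) (auto intro: rat_cone_base)

lemma rat_cone_hull: "rat_cone (submonoid hull G) = rat_cone G"
proof
  have "b \<in> submonoid hull G \<Longrightarrow> rat_vec b \<in> rat_cone G" for b
    by (erule hull_induct)
      (auto simp: submonoid_def rat_vec_zero rat_vec_add rat_cone_zero
        intro: rat_cone_base rat_cone_add)
  then show "rat_cone (submonoid hull G) \<subseteq> rat_cone G" by (rule rat_cone_least)
qed (rule rat_cone_mono, rule hull_subset)

lemma rat_cone_nonneg: "x \<in> rat_cone B \<Longrightarrow> 0 \<le> x $ i"
  by (induction rule: rat_cone_induct) (auto simp: rat_vec_def)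

text \<open>Both cones lie in the nonnegative orthant, so nothing can cancel in any coordinate. Two
  different generating sets are allowed because a cone will be compared with a single ray.\<close>

lemma rat_cone_pointed:
  assumes "x \<in> rat_cone B" "y \<in> rat_cone D" "x + y = 0"
  shows "x = 0"
proof -
  have "x $ i + y $ i = 0" for i using assms(3) by (metis vector_add_component zero_index)
  then show ?thesis
    using rat_cone_nonneg[OF assms(1)] rat_cone_nonneg[OF assms(2)]
    by (simp add: vec_eq_iff add_nonneg_eq_0_iff)
qed

lemma rat_cone_insert:
  assumes "x \<in> rat_cone (insert h B)"
  obtains \<alpha> y where "\<alpha> \<ge> 0" "y \<in> rat_cone B" "x = \<alpha> *s rat_vec h + y"
proof -
  have "\<exists>\<alpha>\<ge>0. \<exists>y\<in>rat_cone B. x = \<alpha> *s rat_vec h + y"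
    using assms
  proof (induction rule: rat_cone_induct)
    case zero
    have "0 = 0 *s rat_vec h + 0" by simp
    then show ?case using rat_cone_zero by blast
  next
    case (add x c b)
    then obtain \<alpha> y where *: "\<alpha> \<ge> 0" "y \<in> rat_cone B" "x = \<alpha> *s rat_vec h + y" by blast
    show ?case
    proof (cases "b = h")
      case True
      have "x + c *s rat_vec b = (\<alpha> + c) *s rat_vec h + y"
        using * True by (simp add: vector_sadd_rdistrib)
      then show ?thesis using * add by (metis add_nonneg_nonneg)
    next
      case False
      then have "y + c *s rat_vec b \<in> rat_cone B" using * add by (auto intro: rat_cone_add_smult)
      moreover have "x + c *s rat_vec b = \<alpha> *s rat_vec h + (y + c *s rat_vec b)"
        using * by simp
      ultimately show ?thesis using * by blast
    qed
  qed
  then show ?thesis using that by blast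
qed

section \<open>Passing between rational cones and integer points\<close>

lemma nonneg_rat_fraction:
  fixes c :: rat
  assumes "c \<ge> 0"
  obtains a d :: nat where "d > 0" "of_nat d * c = of_nat a"
proof -
  obtain a d :: int where q: "quotient_of c = (a, d)" by fastforce
  have d: "d > 0" and c: "c = of_int a / of_int d"
    using quotient_of_denom_pos[OF q] quotient_of_div[OF q] by auto
  have "a \<ge> 0" using assms d c by (simp add: zero_le_divide_iff)
  then have "of_nat (nat d) * c = of_nat (nat a)" using d c by simp
  then show ?thesis using that[of "nat d" "nat a"] d by simp
qed

lemma rat_cone_clear_denominators:
  assumes "x \<in> rat_cone B"
  shows "\<exists>N>0. \<exists>m\<in>submonoid hull B. of_nat N *s x = rat_vec m"
  using assms
proof (induction rule: rat_cone_induct)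
  case zero
  have "of_nat 1 *s 0 = rat_vec 0" by (simp add: rat_vec_zero)
  then show ?case using submonoid_hull_zero zero_less_one by blast
next
  case (add x c b)
  then obtain N m where *: "N > 0" "m \<in> submonoid hull B" "of_nat N *s x = rat_vec m" by blast
  obtain a d :: nat where ad: "d > 0" "of_nat d * c = of_nat a"
    using nonneg_rat_fraction \<open>c \<ge> 0\<close> by blast
  \<comment> \<open>The product of the denominator \<open>d\<close> of \<open>c\<close> and the
    multiplier \<open>N\<close> of \<open>x\<close> clears both summands.\<close>
  have "of_nat (d * N) *s (x + c *s rat_vec b)
    = of_nat d *s (of_nat N *s x) + (of_nat N * (of_nat d * c)) *s rat_vec b"
    by (simp add: vector_add_ldistrib vector_smult_assoc ac_simps)
  also have "\<dots> = rat_vec (d *s m + (N * a) *s b)"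
    using * ad by (simp add: rat_vec_add rat_vec_smult)
  finally have "of_nat (d * N) *s (x + c *s rat_vec b) = rat_vec (d *s m + (N * a) *s b)" .
  moreover have "d *s m + (N * a) *s b \<in> submonoid hull B"
    using * add hull_inc[of b B] by (intro submonoid_hull_add smult_nat_in_submonoid submonoid_hull)
  moreover have "d * N > 0" using * ad by simp
  ultimately show ?case by blast
qed

text \<open>The integer cone contains its generators and so determines the rational cone; condition
  (a) can therefore be handled over the rationals.\<close>

lemma rat_cone_eq_iff_int_cone_eq: "rat_cone B = rat_cone D \<longleftrightarrow> int_cone B = int_cone D"
proof
  have "rat_cone B \<subseteq> rat_cone D" if "int_cone B \<subseteq> int_cone D" for B D :: "(nat ^ 'p) set"
    using that rat_cone_base by (intro rat_cone_least) (auto simp: int_cone_def int_points_def)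
  then show "rat_cone B = rat_cone D" if "int_cone B = int_cone D"
    using that by blast
qed (simp add: int_cone_def)

section \<open>Extremal rays\<close>

text \<open>A nonzero \<open>x\<close> in the face lies strictly between 0 and any larger multiple
  of itself, so both endpoints belong to the face; convexity then supplies the multiples in
  between.\<close>

lemma face_rat_cone_smult:
  assumes F: "field_face_of F (rat_cone B)" and x: "x \<in> F" and c: "c \<ge> 0"
  shows "c *s x \<in> F"
proof (cases "x = 0")
  case False
  have xC: "x \<in> rat_cone B" using F x by (auto simp: field_face_of_def)
  have *: "0 \<in> F \<and> (d + 1) *s x \<in> F" if d: "d > 0" for d
  proof -
    have "d + 1 \<noteq> 0" using d by simp
    then have "x = (1 - 1 / (d + 1)) *s 0 + (1 / (d + 1)) *s ((d + 1) *s x)"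
      by (simp only: vector_smult_assoc vec.scale_zero_right) simp
    moreover have "(0 :: rat ^ 'a) \<noteq> (d + 1) *s x"
      using \<open>d + 1 \<noteq> 0\<close> False vec.scale_eq_0_iff[of "d + 1" x] by metis
    moreover have "0 < 1 / (d + 1)" "1 / (d + 1) < 1" using d by simp_all
    ultimately have "x \<in> field_open_segment 0 ((d + 1) *s x)"
      unfolding field_open_segment_def by blast
    then show ?thesis
      using F x rat_cone_zero[of B] rat_cone_smult[OF xC, of "d + 1"] d
      unfolding field_face_of_def by (meson add_nonneg_nonneg less_imp_le zero_le_one)
  qed
  show ?thesis
  proof (cases "c = 0")
    case True
    then show ?thesis using *[of 1] by simp
  next
    case False
    then have c: "c > 0" using c by simp
    \<comment> \<open>These are the weights that express \<open>c *s x\<close> as a convex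
      combination of 0 and \<open>(c + 1) *s x\<close>.\<close>
    then have "1 / (c + 1) + c / (c + 1) = 1" by (simp add: field_simps)
    moreover have "0 \<le> 1 / (c + 1)" "0 \<le> c / (c + 1)" using c by simp_all
    ultimately have "(1 / (c + 1)) *s 0 + (c / (c + 1)) *s ((c + 1) *s x) \<in> F"
      using *[OF c] F unfolding field_face_of_def field_convex_def by blast
    then show ?thesis
      using c by (simp only: vector_smult_assoc vec.scale_zero_right add_0_left) simp
  qed
qed (use x in simp)

text \<open>Up to scaling, \<open>a + b\<close> is the midpoint of \<open>a\<close> and
  \<open>b\<close>, so the face property applies.\<close>

lemma face_rat_cone_summand:
  assumes F: "field_face_of F (rat_cone B)"
    and ab: "a \<in> rat_cone B" "b \<in> rat_cone B" "a + b \<in> F"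
  shows "a \<in> F"
proof -
  have half: "(1 / 2) *s (a + b) \<in> F" using face_rat_cone_smult[OF F ab(3)] by simp
  show ?thesis
  proof (cases "a = b")
    \<comment> \<open>The open segment is empty here, but the midpoint is \<open>a\<close>
      itself.\<close>
    case True
    then have "(1 / 2) *s (a + b) = a" by (simp add: vec_eq_iff)
    then show ?thesis using half by simp
  next
    case False
    have "(1 / 2) *s (a + b) = (1 - 1 / 2) *s a + (1 / 2) *s b"
      by (simp add: vector_add_ldistrib)
    moreover have "(0::rat) < 1 / 2" "1 / 2 < (1::rat)" by simp_all
    ultimately have "(1 / 2) *s (a + b) \<in> field_open_segment a b"
      using False unfolding field_open_segment_def by blast
    then show ?thesis using F half ab unfolding field_face_of_def by blast
  qed
qed

text \<open>If a point of the ray lies between \<open>a\<close> and \<open>b\<close>, splitting off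
  the multiples of \<open>h\<close> leaves a combination of \<open>a'\<close> and \<open>b'\<close>
  equal to some \<open>\<delta> *s rat_vec h\<close>. Irredundancy excludes
  \<open>\<delta> > 0\<close>, and pointedness then makes both remainders vanish.\<close>

lemma irredundant_generator_ray_face:
  assumes h: "rat_vec h \<notin> rat_cone H"
  shows "field_face_of {c *s rat_vec h | c. c \<ge> 0} (rat_cone (insert h H))"
    (is "field_face_of ?R ?C")
  unfolding field_face_of_def
proof (intro conjI ballI impI)
  show "?R \<subseteq> ?C" by (auto intro: rat_cone_smult rat_cone_base)
  have "u *s (c *s rat_vec h) + v *s (d *s rat_vec h) = (u * c + v * d) *s rat_vec h"
    for u v c d by (simp add: vector_smult_assoc vector_sadd_rdistrib)
  moreover have "u * c + v * d \<ge> 0" if "u \<ge> 0" "v \<ge> 0" "c \<ge> 0" "d \<ge> 0" for u v c d :: rat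
    using that by simp
  ultimately show "field_convex ?R" unfolding field_convex_def by blast
next
  have ray: "a \<in> ?R \<and> b \<in> ?R"
    if "a \<in> ?C" "b \<in> ?C" "x \<in> ?R" "x \<in> field_open_segment a b" for a b x
  proof -
    obtain c u where c: "x = c *s rat_vec h"
      and u: "0 < u" "u < 1" "x = (1 - u) *s a + u *s b"
      using \<open>x \<in> ?R\<close> \<open>x \<in> field_open_segment a b\<close> unfolding field_open_segment_def by blast
    obtain \<alpha> a' where a: "\<alpha> \<ge> 0" "a' \<in> rat_cone H" "a = \<alpha> *s rat_vec h + a'"
      using rat_cone_insert[OF \<open>a \<in> ?C\<close>] .
    obtain \<beta> b' where b: "\<beta> \<ge> 0" "b' \<in> rat_cone H" "b = \<beta> *s rat_vec h + b'"
      using rat_cone_insert[OF \<open>b \<in> ?C\<close>] .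
    define \<delta> where "\<delta> = c - (1 - u) * \<alpha> - u * \<beta>"
    have eq: "(1 - u) *s a' + u *s b' = \<delta> *s rat_vec h"
      using u(3) unfolding c a(3) b(3) \<delta>_def by (simp add: vec_eq_iff algebra_simps)
    have a'C: "(1 - u) *s a' \<in> rat_cone H" and b'C: "u *s b' \<in> rat_cone H"
      using u rat_cone_smult[OF a(2), of "1 - u"] rat_cone_smult[OF b(2), of u] by simp_all
    have "\<not> \<delta> > 0"
    proof
      assume "\<delta> > 0"
      then have "rat_vec h = (1 / \<delta>) *s ((1 - u) *s a' + u *s b')"
        unfolding eq by (simp add: vector_smult_assoc)
      then show False
        using h \<open>\<delta> > 0\<close> rat_cone_smult[OF rat_cone_add[OF a'C b'C], of "1 / \<delta>"] by simp
    qed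
    \<comment> \<open>With \<open>\<delta>\<close> nonpositive, moving its term to the other side
      gives two cone elements with sum 0.\<close>
    then have d: "(- \<delta>) *s rat_vec h \<in> rat_cone {h}"
      by (intro rat_cone_smult rat_cone_base) auto
    have sum0: "((1 - u) *s a' + u *s b') + (- \<delta>) *s rat_vec h = 0"
      unfolding eq by (simp add: vec_eq_iff)
    have "(1 - u) *s a' + u *s b' = 0"
      using rat_cone_pointed[OF rat_cone_add[OF a'C b'C] d sum0] .
    then have "(1 - u) *s a' = 0" "u *s b' = 0"
      using rat_cone_pointed[OF a'C b'C] by simp_all
    then have "a' = 0" "b' = 0"
      using u(1,2) vec.scale_eq_0_iff[of "1 - u" a'] vec.scale_eq_0_iff[of u b'] by auto
    then show ?thesis using a b by auto
  qed
  show "a \<in> ?R" "b \<in> ?R"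
    if "a \<in> ?C" "b \<in> ?C" "x \<in> ?R" "x \<in> field_open_segment a b" for a b x
    using ray[OF that] by blast+
qed

lemma dim_ray:
  fixes v :: "'a::linordered_field ^ 'p"
  assumes "v \<noteq> 0"
  shows "vec.dim {c *s v | c. c \<ge> 0} = 1"
proof (rule vec.dim_unique)
  have "v = 1 *s v" by simp
  then show "{v} \<subseteq> {c *s v | c. c \<ge> 0}" using zero_le_one by blast
  show "{c *s v | c. c \<ge> 0} \<subseteq> vec.span {v}"
    by (auto intro: vec.span_scale vec.span_base)
qed (use assms in auto)

text \<open>Generators lying in the cone of the others are discarded one by one, which stops because
  \<open>G\<close> is finite.\<close>

lemma irredundant_generators:
  assumes "finite G"
  shows "\<exists>H\<subseteq>G. rat_cone H = rat_cone G \<and> (\<forall>h\<in>H. rat_vec h \<notin> rat_cone (H - {h}))"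
  using assms
proof (induction G rule: finite_psubset_induct)
  case (psubset G)
  show ?case
  proof (cases "\<exists>h\<in>G. rat_vec h \<in> rat_cone (G - {h})")
    case True
    then obtain h where h: "h \<in> G" "rat_vec h \<in> rat_cone (G - {h})" by blast
    then have "rat_vec b \<in> rat_cone (G - {h})" if "b \<in> G" for b
      using that rat_cone_base[of b "G - {h}"] by (cases "b = h") auto
    then have "rat_cone (G - {h}) = rat_cone G"
      using rat_cone_least[of G "G - {h}"] rat_cone_mono[of "G - {h}" G] by blast
    moreover have "G - {h} \<subset> G" using h by blast
    ultimately show ?thesis using psubset.IH[of "G - {h}"] by blast
  qed blast
qed

text \<open>Each irredundant generator spans an extremal ray, and a nonzero point of
  \<open>B\<close> on that ray is a positive multiple of it.\<close>

lemma rat_cone_subset_if_meets_extremal_rays: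
  assumes "affine_semigroup S" "\<And>\<tau>. \<tau> \<in> extremal_rays S \<Longrightarrow> (B - {0}) \<inter> \<tau> \<noteq> {}"
  shows "rat_cone S \<subseteq> rat_cone B"
proof -
  obtain G where G: "finite G" "S = submonoid hull G"
    using assms(1) by (auto simp: affine_semigroup_def)
  obtain H where H: "rat_cone H = rat_cone S" "\<And>h. h \<in> H \<Longrightarrow> rat_vec h \<notin> rat_cone (H - {h})"
    using irredundant_generators[OF G(1)] by (auto simp: G(2) rat_cone_hull)
  have "rat_vec h \<in> rat_cone B" if h: "h \<in> H" for h
  proof -
    let ?R = "{c *s rat_vec h | c. c \<ge> 0}"
    have "rat_vec h \<noteq> 0" using H(2)[OF h] rat_cone_zero by metis
    moreover have "field_face_of ?R (rat_cone S)"
      using irredundant_generator_ray_face[OF H(2)[OF h]] h H(1) by (simp add: insert_absorb)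
    ultimately have "int_points ?R \<in> extremal_rays S"
      unfolding extremal_rays_def using dim_ray by blast
    then obtain y where y: "y \<in> B" "y \<noteq> 0" "rat_vec y \<in> ?R"
      using assms(2) by (fastforce simp: int_points_def)
    then obtain c where c: "c \<ge> 0" "rat_vec y = c *s rat_vec h" by blast
    \<comment> \<open>The point \<open>y\<close> is nonzero, so the scaling can be inverted; this is
      where removing 0 from \<open>B\<close> matters.\<close>
    have "c \<noteq> 0" using c(2) y(2) rat_vec_eq_zero_iff[of y] by auto
    then have "rat_vec h = (1 / c) *s rat_vec y" using c(2) by (simp add: vector_smult_assoc)
    then show ?thesis using c(1) y(1) by (auto intro: rat_cone_smult rat_cone_base)
  qed
  then show ?thesis using rat_cone_least[of H B] H(1) by simp
qed

text \<open>A nonzero term in a conic representation of \<open>x\<close> is a summand of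
  \<open>x\<close>, hence lies in the face, and rescaling yields its generator.\<close>

lemma face_rat_cone_meets_generators:
  assumes F: "field_face_of F (rat_cone B)" and "x \<in> rat_cone B" "x \<in> F" "x \<noteq> 0"
  shows "\<exists>b\<in>B. b \<noteq> 0 \<and> rat_vec b \<in> F"
  using assms(2-)
proof (induction rule: rat_cone_induct)
  case (add x c b)
  have cb: "c *s rat_vec b \<in> rat_cone B" using add.hyps by (simp add: rat_cone_smult rat_cone_base)
  show ?case
  proof (cases "c *s rat_vec b = 0")
    case True
    have "x \<in> F" "x \<noteq> 0" using add.prems unfolding True by simp_all
    then show ?thesis by (rule add.IH)
  next
    case False
    then have "c \<noteq> 0" "b \<noteq> 0" by (auto simp: rat_vec_zero)
    have "c *s rat_vec b \<in> F"
      using face_rat_cone_summand[OF F cb \<open>x \<in> rat_cone B\<close>] add.prems by (simp add: add.commute)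
    then have "(1 / c) *s (c *s rat_vec b) \<in> F"
      using face_rat_cone_smult[OF F, of "c *s rat_vec b" "1 / c"] add.hyps by simp
    then have "rat_vec b \<in> F" using \<open>c \<noteq> 0\<close> by (simp add: vector_smult_assoc)
    then show ?thesis using \<open>b \<noteq> 0\<close> add.hyps by blast
  qed
qed simp

section \<open>Ideals\<close>

lemma affine_semigroup_ideal:
  assumes "affine_semigroup S" and P: "semigroup_ideal P S"
    and C: "rat_cone S \<subseteq> rat_cone P"
  shows "affine_semigroup (P \<union> {0})"
proof -
  obtain G where G: "finite G" "S = submonoid hull G"
    using assms(1) by (auto simp: affine_semigroup_def)
  have PS: "P \<subseteq> S" and PI: "\<And>x s. x \<in> P \<Longrightarrow> s \<in> S \<Longrightarrow> x + s \<in> P"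
    using P by (auto simp: semigroup_ideal_def)
  have subP: "submonoid (P \<union> {0})" using PS PI by (auto simp: submonoid_def)
  then have hullP: "submonoid hull P \<subseteq> P \<union> {0}" by (intro hull_minimal) auto
  have "\<exists>n>0. n *s g \<in> P \<union> {0}" if g: "g \<in> G" for g
  proof -
    have "rat_vec g \<in> rat_cone P"
      using C g by (auto simp: G(2) rat_cone_hull intro: rat_cone_base)
    then obtain n m where *: "n > 0" "m \<in> submonoid hull P" "of_nat n *s rat_vec g = rat_vec m"
      using rat_cone_clear_denominators by blast
    \<comment> \<open>Injectivity of \<open>rat_vec\<close> brings the rational identity back to
      natural vectors.\<close>
    then have "m = n *s g" by (metis rat_vec_smult rat_vec_eq_iff)
    then show ?thesis using * hullP by blast
  qed
  then obtain n where n: "\<And>g. g \<in> G \<Longrightarrow> n g > 0 \<and> n g *s g \<in> P \<union> {0}" by metis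
  let ?E = "(\<lambda>g. n g *s g) ` G"
  let ?M = "submonoid hull ?E"
  have nE: "n g > 0 \<and> n g *s g \<in> ?M" if "g \<in> G" for g
    using n that by (auto intro: hull_inc)
  obtain R where R: "finite R" "R \<subseteq> S" "\<forall>s\<in>S. \<exists>r\<in>R. \<exists>t\<in>?M. s = r + t"
    using submonoid_hull_remainders[OF G(1) submonoid_hull nE] G(2) by blast
  obtain A where A: "finite A" "A \<subseteq> P" "\<forall>x\<in>P. \<exists>a\<in>A. \<exists>s\<in>S. x = a + s"
    using submonoid_hull_dickson[OF G(1), of P] PS unfolding G(2) by metis
  \<comment> \<open>Since \<open>P = A + S\<close> and \<open>S = R + ?M\<close>, the sums
    \<open>a + r\<close> together with the generators of \<open>?M\<close> suffice.\<close>
  let ?B = "(\<lambda>(a, r). a + r) ` (A \<times> R) \<union> ?E"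
  \<comment> \<open>The sums \<open>a + r\<close> stay in \<open>P\<close> because \<open>R\<close>
    lies in \<open>S\<close> and \<open>P\<close> is an ideal.\<close>
  have "?B \<subseteq> P \<union> {0}" using A(2) R(2) PI n by fastforce
  then have "submonoid hull ?B \<subseteq> P \<union> {0}" by (rule hull_minimal) (rule subP)
  moreover have "x \<in> submonoid hull ?B" if x: "x \<in> P" for x
  proof -
    obtain a s where as: "a \<in> A" "s \<in> S" "x = a + s" using A(3) x by blast
    obtain r t where rt: "r \<in> R" "t \<in> ?M" "s = r + t" using R(3) as(2) by blast
    have "a + r \<in> ?B" using as(1) rt(1) by force
    then have "a + r \<in> submonoid hull ?B" by (rule hull_inc)
    moreover have "?M \<subseteq> submonoid hull ?B" by (rule hull_mono) blast
    then have "t \<in> submonoid hull ?B" using rt(2) by (rule subsetD)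
    ultimately have "(a + r) + t \<in> submonoid hull ?B" by (rule submonoid_hull_add)
    then show ?thesis using as(3) rt(3) by (simp add: add.assoc)
  qed
  ultimately have "P \<union> {0} = submonoid hull ?B"
    using submonoid_hull_zero by (intro equalityI subsetI) auto
  moreover have "finite ?B" using A(1) R(1) G(1) by simp
  ultimately show ?thesis unfolding affine_semigroup_def by blast
qed

theorem lemma4:
  fixes S P :: "(nat ^ 'p) set"
  assumes "affine_semigroup S"
    and "semigroup_ideal P S"
  shows "(affine_semigroup (P \<union> {0}) \<and> int_cone P = int_cone S) \<longleftrightarrow>
         (\<exists>Y. Y \<subseteq> P - {0} \<and> (\<forall>\<tau>\<in>extremal_rays S. Y \<inter> \<tau> \<noteq> {}))"
proof
  assume "affine_semigroup (P \<union> {0}) \<and> int_cone P = int_cone S"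
  then have C: "rat_cone P = rat_cone S" by (simp add: rat_cone_eq_iff_int_cone_eq)
  \<comment> \<open>The largest candidate \<open>P - {0}\<close> is taken as
    \<open>Y\<close>.\<close>
  have "(P - {0}) \<inter> \<tau> \<noteq> {}" if "\<tau> \<in> extremal_rays S" for \<tau>
  proof -
    obtain F where F: "\<tau> = int_points F" "field_face_of F (rat_cone P)" "vec.dim F = 1"
      using \<open>\<tau> \<in> extremal_rays S\<close> C by (auto simp: extremal_rays_def)
    \<comment> \<open>Dimension one rules out both the empty face and the face
      \<open>{0}\<close>.\<close>
    have "\<not> F \<subseteq> {0}"
      using F(3) vec.dim_le_card[of F "{}"] by auto
    then obtain v where v: "v \<in> F" "v \<noteq> 0" by blast
    moreover have "v \<in> rat_cone P" using F(2) v(1) by (auto simp: field_face_of_def)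
    ultimately show ?thesis
      using face_rat_cone_meets_generators[OF F(2)] F(1) by (auto simp: int_points_def)
  qed
  then show "\<exists>Y. Y \<subseteq> P - {0} \<and> (\<forall>\<tau>\<in>extremal_rays S. Y \<inter> \<tau> \<noteq> {})" by blast
next
  assume "\<exists>Y. Y \<subseteq> P - {0} \<and> (\<forall>\<tau>\<in>extremal_rays S. Y \<inter> \<tau> \<noteq> {})"
  then have "(P - {0}) \<inter> \<tau> \<noteq> {}" if "\<tau> \<in> extremal_rays S" for \<tau>
    using that by blast
  then have C: "rat_cone S \<subseteq> rat_cone P"
    by (rule rat_cone_subset_if_meets_extremal_rays[OF assms(1)])
  moreover have "rat_cone P \<subseteq> rat_cone S"
    using assms(2) by (intro rat_cone_mono) (simp add: semigroup_ideal_def)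
  ultimately have "int_cone P = int_cone S" by (simp add: int_cone_def)
  then show "affine_semigroup (P \<union> {0}) \<and> int_cone P = int_cone S"
    using affine_semigroup_ideal[OF assms C] by simp
qed

end
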